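(* There exist $d\ge 1$ and, for every $n$, a Boolean function $F:\mathbb{F}_2^n\to\{0,1/2\}\subseteq\mathbb{T}$ such that for every classical polynomial $P$ of degree at most $d$, $$\Pr_{x\sim\mathbb{F}_2^n}[F(x)=P(x)] \le \frac12 + o(1),$$ but there is a non-classical polynomial $P'$ of degree $d'\le d$ satisfying $$\Pr_{x\sim\mathbb{F}_2^n}[F(x)=P'(x)] \ge \frac12 + \Omega(1),$$ where $o(1)$ tends to $0$ as $n\to\infty$ and $\Omega(1)$ is bounded below by a positive constant independent of $n$.
   Context: $\mathbb{T}=\mathbb{R}/\mathbb{Z}$. A Boolean function is identified with a map $\mathbb{F}_2^n\to\{0,1/2\}\subseteq\mathbb{T}$. A non-classical polynomial of degree $\le d$ is a function $F:\mathbb{F}_2^n\to\mathbb{T}$ of the form $F(x)=\alpha+\sum \frac{c_{e_1,\dots,e_n,k}\,x_1^{e_1}\cdots x_n^{e_n}}{2^k} \bmod 1$, the sum over $0\le e_1,\dots,e_n\le1$ and $k\ge1$ with $\sum_i e_i+(k-1)\le d$, where $\alpha\in\mathbb{T}$ (the shift) and $c_{e_1,\dots,e_n,k}\in\{0,1\}$; the depth is the largest $k$ with some $c_{e,k}\ne0$. Only polynomials whose shift is of the form $A/2^k$ with $k$ the depth and $A\in\{0,\dots,2^k-1\}$ are considered. Classical polynomials are non-classical polynomials with shift in $\{0,1/2\}$ and depth $1$. Uniform $x$ in probabilities. *)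

theory Defs
  imports "HOL-Probability.Probability" "HOL-Library.Z2"
begin

quotient_type torus = real / "\<lambda>x y. x - y \<in> \<int>"
  morphisms rep_torus to_torus
proof (rule equivpI)
  show "reflp (\<lambda>x y::real. x - y \<in> \<int>)"
    by (simp add: reflp_def)
  show "symp (\<lambda>x y::real. x - y \<in> \<int>)"
    by (metis (no_types, lifting) Ints_minus minus_diff_eq sympI)
  show "transp (\<lambda>x y::real. x - y \<in> \<int>)"
  proof (rule transpI)
    fix x y z :: real
    assume "x - y \<in> \<int>" "y - z \<in> \<int>"
    then have "(x - y) + (y - z) \<in> \<int>" by (rule Ints_add)
    then show "x - z \<in> \<int>" by simp
  qed
qed

instantiation torus :: ab_group_add
begin

lift_definition zero_torus :: torus is 0 .

lift_definition plus_torus :: "torus \<Rightarrow> torus \<Rightarrow> torus" is "(+)"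
proof -
  fix a b c d :: real
  assume "a - b \<in> \<int>" "c - d \<in> \<int>"
  then have "(a - b) + (c - d) \<in> \<int>" by (rule Ints_add)
  then show "a + c - (b + d) \<in> \<int>" by (simp add: algebra_simps)
qed

lift_definition uminus_torus :: "torus \<Rightarrow> torus" is uminus
proof -
  fix a b :: real
  assume "a - b \<in> \<int>"
  then have "- (a - b) \<in> \<int>" by (rule Ints_minus)
  then show "- a - - b \<in> \<int>" by simp
qed

lift_definition minus_torus :: "torus \<Rightarrow> torus \<Rightarrow> torus" is "(-)"
proof -
  fix a b c d :: real
  assume "a - b \<in> \<int>" "c - d \<in> \<int>"
  then have "(a - b) - (c - d) \<in> \<int>" by (rule Ints_diff)
  then show "a - c - (b - d) \<in> \<int>" by (simp add: algebra_simps)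
qed

instance
  by standard (transfer; simp add: algebra_simps)+

end

definition F2_pow :: "nat \<Rightarrow> (nat \<Rightarrow> bit) set" where
  "F2_pow n = {..<n} \<rightarrow>\<^sub>E UNIV"

definition boolean_fun :: "nat \<Rightarrow> ((nat \<Rightarrow> bit) \<Rightarrow> torus) \<Rightarrow> bool" where
  "boolean_fun n F \<longleftrightarrow> (\<forall>x\<in>F2_pow n. F x \<in> {0, to_torus (1/2)})"

definition nc_index :: "nat \<Rightarrow> nat \<Rightarrow> ((nat \<Rightarrow> nat) \<times> nat) set" where
  "nc_index n d =
     {(e, k). e \<in> {..<n} \<rightarrow>\<^sub>E {0, 1} \<and> 1 \<le> k \<and> (\<Sum>i<n. e i) + (k - 1) \<le> d}"

definition nc_eval ::
    "nat \<Rightarrow> nat \<Rightarrow> torus \<Rightarrow> ((nat \<Rightarrow> nat) \<Rightarrow> nat \<Rightarrow> nat) \<Rightarrow> (nat \<Rightarrow> bit) \<Rightarrow> torus" where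
  "nc_eval n d \<alpha> c x =
     \<alpha> + to_torus (\<Sum>(e, k)\<in>nc_index n d.
            real (c e k) * (\<Prod>i<n. (of_bool (x i = 1) :: real) ^ e i) / 2 ^ k)"

text \<open>
  Depth belongs to the representation, not to the function: exponent vector zero is
  an admissible index, so representations are not unique. If all coefficients vanish,
  the depth is taken to be 0.
\<close>

definition nc_depth :: "nat \<Rightarrow> nat \<Rightarrow> ((nat \<Rightarrow> nat) \<Rightarrow> nat \<Rightarrow> nat) \<Rightarrow> nat" where
  "nc_depth n d c = Max (insert 0 {k. \<exists>e. (e, k) \<in> nc_index n d \<and> c e k \<noteq> 0})"

definition nc_represents ::
    "nat \<Rightarrow> nat \<Rightarrow> torus \<Rightarrow> ((nat \<Rightarrow> nat) \<Rightarrow> nat \<Rightarrow> nat) \<Rightarrow> ((nat \<Rightarrow> bit) \<Rightarrow> torus) \<Rightarrow> bool" where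
  "nc_represents n d \<alpha> c P \<longleftrightarrow>
     (\<forall>(e, k)\<in>nc_index n d. c e k \<in> {0, 1}) \<and>
     (\<forall>x\<in>F2_pow n. P x = nc_eval n d \<alpha> c x)"

text \<open>In the following two predicates, \<open>d\<close> is an upper bound on the degree.\<close>

definition nonclassical_poly :: "nat \<Rightarrow> nat \<Rightarrow> ((nat \<Rightarrow> bit) \<Rightarrow> torus) \<Rightarrow> bool" where
  "nonclassical_poly n d P \<longleftrightarrow>
     (\<exists>\<alpha> c. nc_represents n d \<alpha> c P \<and>
        (\<exists>A\<in>{0..2 ^ nc_depth n d c - 1 :: nat}. \<alpha> = to_torus (real A / 2 ^ nc_depth n d c)))"

definition classical_poly :: "nat \<Rightarrow> nat \<Rightarrow> ((nat \<Rightarrow> bit) \<Rightarrow> torus) \<Rightarrow> bool" where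
  "classical_poly n d P \<longleftrightarrow>
     (\<exists>\<alpha> c. nc_represents n d \<alpha> c P \<and> \<alpha> \<in> {0, to_torus (1/2)} \<and> nc_depth n d c = 1)"

definition agreement ::
    "nat \<Rightarrow> ((nat \<Rightarrow> bit) \<Rightarrow> torus) \<Rightarrow> ((nat \<Rightarrow> bit) \<Rightarrow> torus) \<Rightarrow> real" where
  "agreement n F P = measure_pmf.prob (pmf_of_set (F2_pow n)) {x. F x = P x}"

end

theory Submission
  imports Defs "HOL-Library.Ramsey" "HOL-Computational_Algebra.Primes"
begin

text \<open>
  Take \<open>F\<close> to be the binary digit of weight 16 of the Hamming weight \<open>|x|\<close>, that is, the
  elementary symmetric polynomial of degree 16, and \<open>d = 14\<close>. The non-classical polynomial
  \<open>(|x| choose 12) / 8\<close> has degree \<open>12 + 2\<close>. By Kummer's theorem it equals \<open>F\<close> whenever the digit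
  of weight 4 of \<open>|x|\<close> vanishes, and also when \<open>|x| mod 64\<close> has leading digits
  \<open>0001\<close>. As \<open>|x| mod 64\<close> is asymptotically uniform, the agreement tends to
  \<open>1/2 + 1/16\<close>.

  In the other direction, Ramsey's theorem makes a classical polynomial of degree less than 16
  symmetric on large subcubes that partition the whole cube. There it depends only on
  \<open>|x| mod 16\<close>, given which the digit of weight 16 is asymptotically balanced.
\<close>

section \<open>Periodic functions of the Hamming weight\<close>

text \<open>The expectation of \<open>g\<close> at \<open>j\<close> plus the Hamming weight of a
  uniform point of the \<open>n\<close>-cube. The offset \<open>j\<close> is carried along so that
  adding a coordinate becomes a recursion.\<close>

definition weight_mean :: "(nat \<Rightarrow> real) \<Rightarrow> nat \<Rightarrow> nat \<Rightarrow> real" where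
  "weight_mean g n j = (\<Sum>k\<le>n. real (n choose k) * g (k + j)) / 2 ^ n"

lemma weight_mean_0 [simp]: "weight_mean g 0 j = g j"
  by (simp add: weight_mean_def)

text \<open>Pascal's rule: conditioning on one further coordinate averages the offsets
  \<open>j\<close> and \<open>Suc j\<close>.\<close>

lemma weight_mean_Suc:
  "weight_mean g (Suc n) j = (weight_mean g n j + weight_mean g n (Suc j)) / 2"
proof -
  have "(\<Sum>k\<le>Suc n. real (Suc n choose k) * g (k + j)) =
        g j + (\<Sum>k\<le>n. real (Suc n choose Suc k) * g (Suc k + j))"
    by (subst sum.atMost_Suc_shift) simp
  also have "\<dots> = (g j + (\<Sum>k\<le>n. real (n choose Suc k) * g (Suc k + j))) +
        (\<Sum>k\<le>n. real (n choose k) * g (Suc k + j))"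
    by (simp add: algebra_simps sum.distrib)
  also have "g j + (\<Sum>k\<le>n. real (n choose Suc k) * g (Suc k + j)) =
      (\<Sum>k\<le>Suc n. real (n choose k) * g (k + j))"
    by (subst sum.atMost_Suc_shift) simp
  \<comment> \<open>The top term vanishes because \<open>n choose Suc n = 0\<close>.\<close>
  also have "\<dots> = (\<Sum>k\<le>n. real (n choose k) * g (k + j))"
    by simp
  finally show ?thesis
    by (simp add: weight_mean_def field_simps)
qed

lemma weight_mean_periodic:
  assumes "\<And>k. g (k + p) = g k"
  shows "weight_mean g n (j + p) = weight_mean g n j"
  using assms by (simp add: weight_mean_def flip: add.assoc)

lemma weight_mean_bounds:
  assumes "\<And>j. a \<le> weight_mean g n j \<and> weight_mean g n j \<le> b"
  shows "a \<le> weight_mean g (n + l) j \<and> weight_mean g (n + l) j \<le> b"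
proof (induction l arbitrary: j)
  case (Suc l)
  from Suc[of j] Suc[of "Suc j"] show ?case
    by (simp add: weight_mean_Suc)
qed (use assms in simp)

text \<open>After \<open>l\<close> averaging steps the value at \<open>j\<close> is a convex
  combination of the values at \<open>j\<close>, ..., \<open>j + l\<close>. The one at
  \<open>j + i\<close> has weight at least \<open>1 / 2 ^ l\<close>, and the excess of the others
  over \<open>a\<close> is non-negative.\<close>

lemma weight_mean_lower:
  assumes "\<And>j. a \<le> weight_mean g n j" "i \<le> l"
  shows "(weight_mean g n (j + i) - a) / 2 ^ l \<le> weight_mean g (n + l) j - a"
  using assms(2)
proof (induction l arbitrary: i j)
  case (Suc l)
  have ge: "a \<le> weight_mean g (n + l) j" for j
  proof (induction l arbitrary: j)
    case (Suc l)
    from Suc[of j] Suc[of "Suc j"] show ?case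
      by (simp add: weight_mean_Suc)
  qed (use assms in simp)
  have avg: "x / 2 ^ l / 2 \<le> (u + v) / 2 - a" if "x / 2 ^ l \<le> u - a" "a \<le> v" for x u v :: real
  proof -
    have "x / 2 ^ l / 2 \<le> (u - a) / 2"
      using that(1) by (intro divide_right_mono) auto
    also have "\<dots> \<le> (u + v) / 2 - a"
      using that(2) by (simp add: field_simps)
    finally show ?thesis .
  qed
  show ?case
  \<comment> \<open>Of the two averaged terms, the one on the way to \<open>j + i\<close> goes
    through the induction hypothesis; the other is only bounded below by \<open>a\<close>.\<close>
  proof (cases i)
    case 0
    have "(weight_mean g n (j + 0) - a) / 2 ^ l \<le> weight_mean g (n + l) j - a"
      by (rule Suc.IH) simp
    from avg[OF this ge[of "Suc j"]] show ?thesis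
      by (simp add: 0 weight_mean_Suc mult.commute)
  next
    case (Suc i')
    have "(weight_mean g n (Suc j + i') - a) / 2 ^ l \<le> weight_mean g (n + l) (Suc j) - a"
      by (rule Suc.IH) (use Suc Suc.prems in simp)
    from avg[OF this ge[of j]] show ?thesis
      by (simp add: Suc weight_mean_Suc add.commute mult.commute)
  qed
qed simp

text \<open>Over a whole period every value is hit with weight at least \<open>2 ^ -p\<close>, so \<open>p\<close> averaging
  steps contract the oscillation by a fixed factor.\<close>

lemma weight_mean_contract:
  assumes per: "\<And>k. g (k + p) = g k" and p: "p > 0"
    and bd: "\<And>j. a \<le> weight_mean g n j \<and> weight_mean g n j \<le> a + D"
  obtains a' where "\<And>j. a' \<le> weight_mean g (n + p) j \<and>
      weight_mean g (n + p) j \<le> a' + (1 - 1 / 2 ^ Suc p) * D"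
proof (cases "\<exists>j'. weight_mean g n j' \<ge> a + D / 2")
  \<comment> \<open>Some value lies in the upper half of the band. By periodicity every position
    meets it within \<open>p\<close> steps, so the lower bound rises.\<close>
  case True
  then obtain j' where j': "weight_mean g n j' \<ge> a + D / 2" ..
  have perm: "weight_mean g n (j + p * t) = weight_mean g n j" for j t
  proof (induction t)
    case (Suc t)
    have "weight_mean g n (j + p * Suc t) = weight_mean g n ((j + p * t) + p)"
      by (simp add: algebra_simps)
    with Suc show ?case by (simp only: weight_mean_periodic[where g = g and p = p, OF per])
  qed simp
  have "a + D / 2 ^ Suc p \<le> weight_mean g (n + p) j" for j
  proof -
    \<comment> \<open>Adding \<open>p * j\<close> keeps the natural subtraction exact, so
      \<open>j + i\<close> is congruent to \<open>j'\<close> modulo \<open>p\<close>, with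
      \<open>i < p\<close>.\<close>
    define i where "i = (j' + p * j - j) mod p"
    have "j \<le> j' + p * j" using p by (simp add: trans_le_add2)
    then have "j + i + p * ((j' + p * j - j) div p) = j' + p * j"
      by (simp add: i_def)
    then have "weight_mean g n (j + i) = weight_mean g n j'"
      using perm by metis
    moreover have "(weight_mean g n (j + i) - a) / 2 ^ p \<le> weight_mean g (n + p) j - a"
      by (rule weight_mean_lower) (use bd p in \<open>auto simp: i_def less_imp_le\<close>)
    moreover have "(D / 2) / 2 ^ p \<le> (weight_mean g n j' - a) / 2 ^ p"
      using j' by (intro divide_right_mono) auto
    ultimately show ?thesis by simp
  qed
  moreover have "weight_mean g (n + p) j \<le> a + D" for j
    using weight_mean_bounds[OF bd] by blast
  ultimately show ?thesis
    by (intro that[of "a + D / 2 ^ Suc p"]) (simp add: algebra_simps)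
next
  \<comment> \<open>The upper half of the band is empty, so its width has already halved, and
    \<open>1 / 2 \<le> 1 - 1 / 2 ^ Suc p\<close>.\<close>
  case False
  have D: "D \<ge> 0" using bd[of 0] by linarith
  from False bd have "\<And>j. a \<le> weight_mean g n j \<and> weight_mean g n j \<le> a + D / 2"
    by (meson le_less_linear less_imp_le)
  from weight_mean_bounds[OF this, of p]
  have *: "a \<le> weight_mean g (n + p) j \<and> weight_mean g (n + p) j \<le> a + D / 2" for j .
  have "D / 2 \<le> (1 - 1 / 2 ^ Suc p) * D"
  proof -
    have "(1::real) / 2 ^ Suc p \<le> 1 / 2"
      by (simp add: field_simps)
    then have "1 / 2 * D \<le> (1 - 1 / 2 ^ Suc p) * D"
      using D by (intro mult_right_mono) linarith+
    then show ?thesis by simp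
  qed
  with * show ?thesis
    by (intro that[of a]) (meson add_left_mono order_trans)
qed

definition osc :: "nat \<Rightarrow> nat \<Rightarrow> real" where
  "osc p n = (1 - 1 / 2 ^ Suc p) ^ (n div p)"

text \<open>The band starts with width 1 and contracts once per block of \<open>p\<close> steps; the
  remaining \<open>n mod p\<close> steps are averages and cannot widen it.\<close>

lemma weight_mean_osc:
  assumes per: "\<And>k. g (k + p) = g k" and p: "p > 0"
    and g: "\<And>k. 0 \<le> g k \<and> g k \<le> 1"
  shows "\<bar>weight_mean g n i - weight_mean g n j\<bar> \<le> osc p n"
proof -
  have "\<exists>a. \<forall>j. a \<le> weight_mean g (t * p) j \<and>
      weight_mean g (t * p) j \<le> a + (1 - 1 / 2 ^ Suc p) ^ t" for t
  proof (induction t)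
    case 0
    show ?case using g by (intro exI[of _ 0]) simp
  next
    case (Suc t)
    then obtain a where "\<And>j. a \<le> weight_mean g (t * p) j \<and>
      weight_mean g (t * p) j \<le> a + (1 - 1 / 2 ^ Suc p) ^ t" by blast
    from weight_mean_contract[OF per p this] obtain a' where
      "\<And>j. a' \<le> weight_mean g (t * p + p) j \<and> weight_mean g (t * p + p) j \<le>
         a' + (1 - 1 / 2 ^ Suc p) * (1 - 1 / 2 ^ Suc p) ^ t" by blast
    then show ?case by (intro exI[of _ a']) (simp add: add.commute)
  qed
  from this[of "n div p"] obtain a where
    "\<And>j. a \<le> weight_mean g (n div p * p) j \<and> weight_mean g (n div p * p) j \<le> a + osc p n"
    unfolding osc_def by blast
  from weight_mean_bounds[OF this, of "n mod p"]
  have "a \<le> weight_mean g n j \<and> weight_mean g n j \<le> a + osc p n" for j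
    by simp
  from this[of i] this[of j] show ?thesis by linarith
qed

lemma osc_tendsto_0:
  assumes "p > 0"
  shows "osc p \<longlonglongrightarrow> 0"
proof -
  have "(1::real) / 2 ^ Suc p \<le> 1 / 2"
    by (simp add: field_simps)
  moreover have "(1::real) / 2 ^ Suc p > 0"
    by simp
  ultimately have "norm (1 - 1 / 2 ^ Suc p :: real) < 1"
    unfolding real_norm_def by linarith
  then have "(\<lambda>t. (1 - 1 / 2 ^ Suc p :: real) ^ t) \<longlonglongrightarrow> 0"
    by (rule LIMSEQ_power_zero)
  moreover have "filterlim (\<lambda>n. n div p) sequentially sequentially"
  proof (unfold filterlim_at_top, intro allI)
    fix Z show "\<forall>\<^sub>F n in sequentially. Z \<le> n div p"
      using eventually_ge_at_top[of "Z * p"]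
      by eventually_elim (use assms in \<open>simp add: less_eq_div_iff_mult_less_eq\<close>)
  qed
  ultimately show ?thesis
    unfolding osc_def by (rule filterlim_compose)
qed

text \<open>Each step averages a periodic function with its cyclic shift, which preserves the sum
  over a period.\<close>

lemma weight_mean_sum_period:
  assumes per: "\<And>k. g (k + p) = g k"
  shows "(\<Sum>j<p. weight_mean g n j) = (\<Sum>j<p. g j)"
proof (induction n)
  case (Suc n)
  have "(\<Sum>j<p. weight_mean g n (Suc j)) = (\<Sum>j<p. weight_mean g n j)"
  proof -
    have "(\<Sum>j<p. weight_mean g n (Suc j)) + weight_mean g n 0 = (\<Sum>j<Suc p. weight_mean g n j)"
      by (subst sum.lessThan_Suc_shift) simp
    also have "\<dots> = (\<Sum>j<p. weight_mean g n j) + weight_mean g n 0"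
      using weight_mean_periodic[of g p n 0] per by simp
    finally show ?thesis by simp
  qed
  then show ?case
    using Suc by (simp add: weight_mean_Suc sum.distrib flip: sum_divide_distrib)
qed simp

text \<open>The values over one period have the same mean as \<open>g\<close>, and they all lie
  within \<open>osc p n\<close> of the value at 0.\<close>

lemma weight_mean_period_mean:
  assumes per: "\<And>k. g (k + p) = g k" and p: "p > 0"
    and g: "\<And>k. 0 \<le> g k \<and> g k \<le> 1"
  shows "\<bar>weight_mean g n 0 - (\<Sum>j<p. g j) / p\<bar> \<le> osc p n"
proof -
  have "real p * weight_mean g n 0 - (\<Sum>j<p. g j) = (\<Sum>j<p. weight_mean g n 0 - weight_mean g n j)"
    using weight_mean_sum_period[of g p n] per by (simp add: sum_subtractf)
  also have "\<bar>\<dots>\<bar> \<le> (\<Sum>j<p. osc p n)"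
    by (rule order_trans[OF sum_abs]) (intro sum_mono weight_mean_osc per p g)
  finally have "\<bar>real p * weight_mean g n 0 - (\<Sum>j<p. g j)\<bar> \<le> p * osc p n"
    by simp
  moreover have "real p * weight_mean g n 0 - (\<Sum>j<p. g j) =
      p * (weight_mean g n 0 - (\<Sum>j<p. g j) / p)"
    using p by (simp add: field_simps)
  ultimately show ?thesis
    using p by (simp add: abs_mult)
qed

text \<open>Grouping subsets by size produces the binomial weights; this reduces counting in the
  cube to \<open>weight_mean\<close>.\<close>

lemma card_Pow_weight:
  assumes "finite V"
  shows "real (card {X \<in> Pow V. Q (card X)}) =
    2 ^ card V * weight_mean (\<lambda>k. of_bool (Q k)) (card V) 0"
proof -
  have "real (card {X \<in> Pow V. Q (card X)}) = (\<Sum>X\<in>Pow V. of_bool (Q (card X)))"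
    using assms by (subst sum_of_bool_eq) (auto intro!: arg_cong[of _ _ card])
  also have "\<dots> = (\<Sum>k\<le>card V. \<Sum>X\<in>{X\<in>Pow V. card X = k}. of_bool (Q (card X)))"
    using assms by (intro sum.group[symmetric]) (auto intro: card_mono)
  also have "\<dots> = (\<Sum>k\<le>card V. real (card V choose k) * of_bool (Q k))"
  proof (intro sum.cong refl)
    fix k
    have "card {X \<in> Pow V. card X = k} = card V choose k"
      using n_subsets[OF assms] by simp
    then show "(\<Sum>X\<in>{X\<in>Pow V. card X = k}. of_bool (Q (card X))) =
        real (card V choose k) * of_bool (Q k)" by simp
  qed
  finally show ?thesis
    by (simp add: weight_mean_def)
qed

section \<open>Low-degree polynomials over the two-element field\<close>

text \<open>The two-colour Ramsey theorem for \<open>r\<close>-element sets, carried from an initial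
  segment of the naturals to \<open>V\<close> along a bijection.\<close>

lemma ramsey_homogeneous_subset:
  "\<exists>N. \<forall>V col. finite V \<longrightarrow> N \<le> card V \<longrightarrow>
     (\<exists>T\<subseteq>V. card T = m \<and> (\<exists>b::bool. \<forall>S\<subseteq>T. card S = r \<longrightarrow> col (S :: 'a set) = b))"
proof -
  define N where "N = ES r m m"
  have N: "partn_lst {..<N} [m, m] r"
    unfolding N_def by (rule ramsey2_full)
  show ?thesis
  proof (intro exI[of _ N] allI impI)
    fix V :: "'a set" and col
    assume V: "finite V" "N \<le> card V"
    then obtain W where W: "W \<subseteq> V" "card W = N" "finite W"
      by (meson obtain_subset_with_card_n)
    then obtain g where g: "bij_betw g {..<N} W"
      using ex_bij_betw_nat_finite[of W] by (auto simp: atLeast0LessThan)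
    define f where "f S = (if col (g ` S) then 1 else 0 :: nat)" for S
    have "f \<in> nsets {..<N} r \<rightarrow> {..<length [m, m]}"
      by (auto simp: f_def)
    then obtain i where i: "i < 2" "monochromatic {..<N} ([m, m] ! i) r f i"
      using N unfolding partn_lst_def by (auto simp: numeral_2_eq_2)
    moreover have "[m, m] ! i = m"
      using i(1) less_2_cases by fastforce
    ultimately obtain H where H: "H \<in> nsets {..<N} m" "f ` nsets H r \<subseteq> {i}"
      unfolding monochromatic_def by auto
    have inj: "inj_on g H"
      using H(1) g by (auto simp: nsets_def bij_betw_def intro: inj_on_subset)
    show "\<exists>T\<subseteq>V. card T = m \<and> (\<exists>b. \<forall>S\<subseteq>T. card S = r \<longrightarrow> col S = b)"
    proof (intro exI[of _ "g ` H"] conjI exI[of _ "i = 1"] allI impI)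
      show "g ` H \<subseteq> V"
        using H(1) g W(1) by (auto simp: nsets_def bij_betw_def)
      show "card (g ` H) = m"
        using inj H(1) by (simp add: card_image nsets_def)
      fix S assume S: "S \<subseteq> g ` H" "card S = r"
      then obtain S' where S': "S' \<subseteq> H" "S = g ` S'"
        by (meson subset_image_iff)
      then have "card S' = r"
        using S(2) inj by (metis card_image inj_on_subset)
      moreover have "finite S'"
        using S' H(1) by (auto simp: nsets_def intro: finite_subset)
      ultimately have "f S' = i"
        using H(2) S' by (auto simp: nsets_def)
      then show "col S = (i = 1)"
        by (auto simp: f_def S' split: if_splits)
    qed
  qed
qed

text \<open>With the variables in \<open>Y\<close> fixed, a polynomial of degree at most
  \<open>r\<close> becomes one in the variables of \<open>X\<close>. Its terms of degree
  \<open>r\<close> keep their coefficients; fixing \<open>Y\<close> only alters the lower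
  ones.\<close>

lemma sum_subsets_Un:
  fixes a :: "'a set \<Rightarrow> nat"
  assumes fin: "finite X" "finite Y" and disj: "X \<inter> Y = {}"
  shows "(\<Sum>S | S \<subseteq> X \<union> Y \<and> card S < Suc r. a S) =
    (\<Sum>S | S \<subseteq> X \<and> card S < r. \<Sum>S' | S' \<subseteq> Y \<and> card S + card S' \<le> r. a (S \<union> S')) +
    (\<Sum>S | S \<subseteq> X \<and> card S = r. a S)"
proof -
  let ?B = "\<lambda>S. {S'. S' \<subseteq> Y \<and> card S + card S' \<le> r}"
  let ?b = "\<lambda>S. \<Sum>S'\<in>?B S. a (S \<union> S')"
  have card_Un: "card (S \<union> S') = card S + card S'" if "S \<subseteq> X" "S' \<subseteq> Y" for S S'
    using that fin disj by (intro card_Un_disjoint) (auto intro: finite_subset)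
  have card_Int: "card (S \<inter> X) + card (S \<inter> Y) = card S" if "S \<subseteq> X \<union> Y" for S
    using card_Un[of "S \<inter> X" "S \<inter> Y"] that by (simp add: Int_Un_distrib[symmetric] Int_absorb2)
  have "(\<Sum>S | S \<subseteq> X \<union> Y \<and> card S < Suc r. a S) =
      (\<Sum>(S, S')\<in>(SIGMA S:{S. S \<subseteq> X \<and> card S \<le> r}. ?B S). a (S \<union> S'))"
    by (rule sum.reindex_bij_witness[where i = "\<lambda>(S, S'). S \<union> S'" and j = "\<lambda>S. (S \<inter> X, S \<inter> Y)"])
      (use disj in \<open>auto simp: card_Un card_Int Int_Un_distrib2 Int_absorb2
        simp flip: Int_Un_distrib intro: order_trans[OF le_add1 eq_refl[OF card_Int], THEN order_trans]\<close>)
  also have "\<dots> = (\<Sum>S | S \<subseteq> X \<and> card S \<le> r. ?b S)"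
    using fin by (intro sum.Sigma[symmetric]) auto
  also have "{S. S \<subseteq> X \<and> card S \<le> r} = {S. S \<subseteq> X \<and> card S < r} \<union> {S. S \<subseteq> X \<and> card S = r}"
    by auto
  also have "(\<Sum>S\<in>\<dots>. ?b S) =
      (\<Sum>S | S \<subseteq> X \<and> card S < r. ?b S) + (\<Sum>S | S \<subseteq> X \<and> card S = r. ?b S)"
    using fin by (intro sum.union_disjoint) auto
  \<comment> \<open>A set \<open>S\<close> of size \<open>r\<close> uses up the whole degree,
    leaving only the empty set for \<open>S'\<close>.\<close>
  also have "(\<Sum>S | S \<subseteq> X \<and> card S = r. ?b S) = (\<Sum>S | S \<subseteq> X \<and> card S = r. a S)"
  proof (intro sum.cong refl)
    fix S assume "S \<in> {S. S \<subseteq> X \<and> card S = r}"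
    then have "?B S = {{}}"
      using fin(2) by (auto dest: finite_subset)
    then show "?b S = a S" by simp
  qed
  finally show ?thesis .
qed

section \<open>Parity of sums and binomial coefficients modulo powers of two\<close>

lemma even_sum_cong:
  fixes f g :: "'a \<Rightarrow> nat"
  assumes "\<And>x. x \<in> A \<Longrightarrow> even (f x) = even (g x)"
  shows "even (sum f A) = even (sum g A)"
  using assms by (induction A rule: infinite_finite_induct) auto

text \<open>By absorption \<open>2 ^ (a + b)\<close> divides
  \<open>i * (2 ^ (a + b) choose i)\<close>. Since \<open>i < 2 ^ a\<close> contains fewer than
  \<open>a\<close> factors 2, at least \<open>b + 1\<close> of them remain for the binomial
  coefficient.\<close>

lemma power_2_dvd_choose:
  assumes "0 < i" "i < 2 ^ a"
  shows "2 ^ Suc b dvd (2 ^ (a + b) choose i :: nat)"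
proof -
  have "i * (2 ^ (a + b) choose i) = 2 ^ (a + b) * ((2 ^ (a + b) - 1) choose (i - 1))"
    using assms(1) by (intro times_binomial_minus1_eq)
  then have "2 ^ (a + b) dvd i * (2 ^ (a + b) choose i)"
    by simp
  moreover have "\<not> 2 ^ a dvd i"
    using assms by (auto dest: dvd_imp_le)
  ultimately show ?thesis
    using prime_elem_power_dvd_cases[of 2 "a + b" i "2 ^ (a + b) choose i" a "Suc b"]
      prime_imp_prime_elem[OF two_is_prime_nat] by simp
qed

text \<open>In Vandermonde's expansion every term except \<open>i = 0\<close> is divisible by
  \<open>2 ^ Suc b\<close>.\<close>

lemma choose_add_power_2_mod:
  assumes "r < 2 ^ a"
  shows "((k + 2 ^ (a + b)) choose r) mod 2 ^ Suc b = (k choose r) mod (2 ^ Suc b :: nat)"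
proof -
  have "(k + 2 ^ (a + b)) choose r = (\<Sum>i\<le>r. (2 ^ (a + b) choose i) * (k choose (r - i)))"
    by (simp only: vandermonde add.commute[of k])
  also have "{..r} = insert 0 {1..r}"
    by auto
  also have "(\<Sum>i\<in>insert 0 {1..r}. (2 ^ (a + b) choose i) * (k choose (r - i))) =
      (k choose r) + (\<Sum>i\<in>{1..r}. (2 ^ (a + b) choose i) * (k choose (r - i)))"
    by simp
  finally have "(k + 2 ^ (a + b)) choose r =
      (k choose r) + (\<Sum>i\<in>{1..r}. (2 ^ (a + b) choose i) * (k choose (r - i)))" .
  moreover have "2 ^ Suc b dvd (\<Sum>i\<in>{1..r}. (2 ^ (a + b) choose i) * (k choose (r - i)))"
    using assms by (intro dvd_sum dvd_mult2 power_2_dvd_choose) auto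
  ultimately show ?thesis
    by (elim dvdE) (simp only: mod_mult_self2)
qed

text \<open>This is the source of the degree bound: a shift by 16 flips the digit of weight 16 but
  preserves the parity of all binomial coefficients of lower index.\<close>

lemma even_choose_add_16:
  assumes "r < 16"
  shows "even ((k + 16) choose r) = even (k choose r)"
  using choose_add_power_2_mod[of r 4 k 0] assms by (simp only: even_iff_mod_2_eq_zero) simp

text \<open>Shifting the weight by 16 flips the digit and keeps the parity of \<open>h\<close>, so
  exactly one of \<open>k\<close> and \<open>k + 16\<close> gives agreement and the mean over a
  period of 32 is 1/2. The offset \<open>c\<close> allows for variables already fixed to 1.\<close>

lemma weight_agreement_le:
  assumes fin: "finite V" and h: "\<And>k. even (h (k + 16)) = even (h k :: nat)"
  shows "real (card {X \<in> Pow V. odd ((card X + c) div 16) = odd (h (card X))}) \<le>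
     (1 / 2 + osc 32 (card V)) * 2 ^ card V"
proof -
  define g where "g k = (of_bool (odd ((k + c) div 16) = odd (h k)) :: real)" for k
  have g16: "g (k + 16) = 1 - g k" for k
  proof -
    have "(k + 16 + c) div 16 = Suc ((k + c) div 16)"
      using div_add_self2[of 16 "k + c"] by (simp add: algebra_simps)
    then show ?thesis
      using h[of k] by (simp add: g_def)
  qed
  have per: "g (k + 32) = g k" for k
    using g16[of k] g16[of "k + 16"] by (simp add: add.commute)
  have "(\<Sum>j<32. g j) = (\<Sum>j<16. g j) + (\<Sum>j<16. g (j + 16))"
    using sum.atLeastLessThan_concat[of 0 16 32 g] sum.shift_bounds_nat_ivl[of g 0 16 16]
    by (simp add: atLeast0LessThan)
  also have "\<dots> = 16"
    by (simp add: g16 sum_subtractf)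
  finally have "\<bar>weight_mean g (card V) 0 - 1 / 2\<bar> \<le> osc 32 (card V)"
    using weight_mean_period_mean[of g 32 "card V"] per by (simp add: g_def)
  then have "weight_mean g (card V) 0 \<le> 1 / 2 + osc 32 (card V)"
    by linarith
  then show ?thesis
    using card_Pow_weight[OF fin, of "\<lambda>k. odd ((k + c) div 16) = odd (h k)"]
    by (simp add: g_def[abs_def] mult.commute)
qed

text \<open>Alon and Beigel's argument: by Ramsey's theorem the degree \<open>r\<close> part of the polynomial becomes
  symmetric on some large set \<open>T\<close> of variables. Fixing the other variables in all possible ways
  partitions the cube into subcubes on which only terms of degree less than \<open>r\<close> remain to be
  symmetrised.\<close>

lemma polynomial_agreement_le:
  assumes "r \<le> 16" "\<epsilon> > 0"
  shows "\<exists>N. \<forall>V h c a. finite V \<longrightarrow> N \<le> card V \<longrightarrow> (\<forall>k. even (h (k + 16)) = even (h k :: nat)) \<longrightarrow>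
     real (card {X \<in> Pow V. odd ((card X + c) div 16) =
       odd (h (card X) + (\<Sum>S | S \<subseteq> X \<and> card S < r. a (S :: 'a set) :: nat))})
     \<le> (1 / 2 + \<epsilon>) * 2 ^ card V"
  using assms(1)
proof (induction r)
  \<comment> \<open>No monomials are left, so only the symmetric part \<open>h\<close>
    remains.\<close>
  case 0
  have "\<forall>\<^sub>F n in sequentially. osc 32 n < \<epsilon>"
    using osc_tendsto_0[of 32] assms(2) by (simp add: order_tendstoD)
  then obtain N where N: "\<And>n. n \<ge> N \<Longrightarrow> osc 32 n < \<epsilon>"
    by (auto simp: eventually_sequentially)
  show ?case
  proof (intro exI[of _ N] allI impI)
    fix V :: "'a set" and h :: "nat \<Rightarrow> nat" and c and a :: "'a set \<Rightarrow> nat"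
    assume V: "finite V" "N \<le> card V" and h: "\<forall>k. even (h (k + 16)) = even (h k)"
    have "real (card {X \<in> Pow V. odd ((card X + c) div 16) = odd (h (card X))})
        \<le> (1 / 2 + osc 32 (card V)) * 2 ^ card V"
      using V h by (intro weight_agreement_le) auto
    also have "\<dots> \<le> (1 / 2 + \<epsilon>) * 2 ^ card V"
      using N[OF V(2)] by (intro mult_right_mono) auto
    finally show "real (card {X \<in> Pow V. odd ((card X + c) div 16) =
        odd (h (card X) + (\<Sum>S | S \<subseteq> X \<and> card S < 0. a S))}) \<le> (1 / 2 + \<epsilon>) * 2 ^ card V"
      by simp
  qed
next
  case (Suc r)
  let ?good = "\<lambda>h c a r X. odd ((card X + c) div 16) =
      odd (h (card X) + (\<Sum>S | S \<subseteq> X \<and> card S < r. a (S :: 'a set) :: nat))"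
  from Suc obtain m where m: "\<And>V h c a. finite V \<Longrightarrow> m \<le> card V \<Longrightarrow>
      \<forall>k. even (h (k + 16)) = even (h k :: nat) \<Longrightarrow>
      real (card {X \<in> Pow V. ?good h c a r X}) \<le> (1 / 2 + \<epsilon>) * 2 ^ card V"
    by (meson Suc_leD)
  \<comment> \<open>\<open>N\<close> is so large that Ramsey's theorem leaves \<open>m\<close>
    variables, the threshold given by the induction hypothesis.\<close>
  obtain N where N: "\<And>V col. finite V \<Longrightarrow> N \<le> card V \<Longrightarrow>
     \<exists>T\<subseteq>V. card T = m \<and> (\<exists>b::bool. \<forall>S\<subseteq>T. card S = r \<longrightarrow> col (S :: 'a set) = b)"
    using ramsey_homogeneous_subset[of m r] by blast
  show ?case
  proof (intro exI[of _ N] allI impI)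
    fix V :: "'a set" and h :: "nat \<Rightarrow> nat" and c and a :: "'a set \<Rightarrow> nat"
    assume V: "finite V" "N \<le> card V" and h: "\<forall>k. even (h (k + 16)) = even (h k)"
    \<comment> \<open>Only parities of coefficients matter, so the parity serves as the
      colour.\<close>
    obtain T b where T: "T \<subseteq> V" "card T = m" and b: "\<And>S. S \<subseteq> T \<Longrightarrow> card S = r \<Longrightarrow> odd (a S) = b"
      using N[OF V, of "\<lambda>S. odd (a S)"] by blast
    have finT: "finite T"
      using T V finite_subset by blast
    define Z where "Z Y = {X \<in> Pow T. ?good h c a (Suc r) (X \<union> Y)}" for Y
    have Z: "real (card (Z Y)) \<le> (1 / 2 + \<epsilon>) * 2 ^ m" if Y: "Y \<subseteq> V - T" for Y
    proof -
      \<comment> \<open>Fixing \<open>Y\<close> adds \<open>card Y\<close> to the weight. The degree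
        \<open>r\<close> coefficients on \<open>T\<close> share the parity \<open>b\<close>, so
        their sum has the parity of \<open>of_bool b * (card X choose r)\<close> and joins the
        symmetric part; \<open>a'\<close> collects the remaining terms by their trace on
        \<open>T\<close>.\<close>
      define h' where "h' k = h (k + card Y) + of_bool b * (k choose r)" for k
      define a' where "a' S = (\<Sum>S' | S' \<subseteq> Y \<and> card S + card S' \<le> r. a (S \<union> S'))" for S
      have finY: "finite Y"
        using Y V finite_subset by blast
      \<comment> \<open>\<open>Suc r \<le> 16\<close> gives \<open>r < 16\<close>, so the absorbed
        binomial keeps the period 16.\<close>
      have "even (h' (k + 16)) = even (h' k)" for k
        using h[rule_format, of "k + card Y"] even_choose_add_16[of r k] Suc.prems
        by (simp add: h'_def add_ac)
      moreover have "?good h c a (Suc r) (X \<union> Y) = ?good h' (c + card Y) a' r X"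
        if X: "X \<subseteq> T" for X
      proof -
        have finX: "finite X" and disj: "X \<inter> Y = {}"
          using X Y finT finite_subset by auto
        have "even (\<Sum>S | S \<subseteq> X \<and> card S = r. a S) = even (\<Sum>S | S \<subseteq> X \<and> card S = r. of_bool b :: nat)"
        proof (rule even_sum_cong)
          fix S assume "S \<in> {S. S \<subseteq> X \<and> card S = r}"
          then show "even (a S) = even (of_bool b :: nat)"
            using b[of S] X by auto
        qed
        also have "(\<Sum>S | S \<subseteq> X \<and> card S = r. of_bool b :: nat) = of_bool b * (card X choose r)"
          using n_subsets[OF finX] by simp
        finally show ?thesis
          unfolding sum_subsets_Un[OF finX finY disj] h'_def a'_def card_Un_disjoint[OF finX finY disj]
          by (auto simp: add_ac)
      qed
      ultimately show ?thesis
        using m[of T h' "c + card Y" a'] finT T(2) unfolding Z_def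
        by (simp cong: conj_cong)
    qed
    \<comment> \<open>The cube over \<open>V\<close> splits into copies of the cube over
      \<open>T\<close>, indexed by the trace \<open>Y\<close> outside \<open>T\<close>.\<close>
    have "{X \<in> Pow V. ?good h c a (Suc r) X} = (\<lambda>(Y, X). X \<union> Y) ` (SIGMA Y:Pow (V - T). Z Y)"
    proof (intro set_eqI iffI)
      fix X assume "X \<in> {X \<in> Pow V. ?good h c a (Suc r) X}"
      moreover have "X = (X \<inter> T) \<union> (X - T)" by blast
      ultimately have "(X - T, X \<inter> T) \<in> (SIGMA Y:Pow (V - T). Z Y)"
        unfolding Z_def by auto
      then show "X \<in> (\<lambda>(Y, X). X \<union> Y) ` (SIGMA Y:Pow (V - T). Z Y)"
        by (rule rev_image_eqI) auto
    next
      fix X assume "X \<in> (\<lambda>(Y, X). X \<union> Y) ` (SIGMA Y:Pow (V - T). Z Y)"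
      then show "X \<in> {X \<in> Pow V. ?good h c a (Suc r) X}"
        using T(1) unfolding Z_def by auto
    qed
    moreover have "finite (SIGMA Y:Pow (V - T). Z Y)"
      using V(1) finT by (intro finite_SigmaI) (auto simp: Z_def)
    ultimately have "card {X \<in> Pow V. ?good h c a (Suc r) X} \<le> card (SIGMA Y:Pow (V - T). Z Y)"
      by (simp only: card_image_le)
    also have "\<dots> = (\<Sum>Y\<in>Pow (V - T). card (Z Y))"
      using V(1) finT by (intro card_SigmaI) (auto simp: Z_def)
    finally have "real (card {X \<in> Pow V. ?good h c a (Suc r) X}) \<le> (\<Sum>Y\<in>Pow (V - T). real (card (Z Y)))"
      by (simp flip: of_nat_sum)
    also have "\<dots> \<le> (\<Sum>Y\<in>Pow (V - T). (1 / 2 + \<epsilon>) * 2 ^ m)"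
      by (intro sum_mono Z) auto
    also have "\<dots> = (1 / 2 + \<epsilon>) * (2 ^ m * 2 ^ card (V - T))"
      using V(1) by (simp add: card_Pow)
    also have "2 ^ m * 2 ^ card (V - T) = (2 ^ card V :: real)"
      using T V(1) finT card_mono[OF V(1) T(1)]
      by (simp add: card_Diff_subset flip: power_add)
    finally show "real (card {X \<in> Pow V. ?good h c a (Suc r) X}) \<le> (1 / 2 + \<epsilon>) * 2 ^ card V" .
  qed
qed

section \<open>Polynomials as functions of subsets\<close>

lemma to_torus_eq_iff: "to_torus a = to_torus b \<longleftrightarrow> a - b \<in> \<int>"
  by (rule torus.abs_eq_iff)

lemma to_torus_add: "to_torus a + to_torus b = to_torus (a + b)"
  by (rule plus_torus.abs_eq)

lemma to_torus_0: "to_torus 0 = 0"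
  by (simp add: zero_torus.abs_eq)

lemma to_torus_half_eq_iff:
  "to_torus (real a / 2) = to_torus (real b / 2) \<longleftrightarrow> odd a = odd b"
proof -
  have "real a / 2 - real b / 2 \<in> \<int> \<longleftrightarrow> (\<exists>z. real a / 2 - real b / 2 = of_int z)"
    by (auto elim: Ints_cases)
  also have "\<dots> \<longleftrightarrow> (\<exists>z. int a - int b = 2 * z)"
  proof (intro ex_cong1)
    fix z
    have "real a / 2 - real b / 2 = of_int z \<longleftrightarrow> real_of_int (int a - int b) = real_of_int (2 * z)"
      by (auto simp: field_simps)
    then show "real a / 2 - real b / 2 = of_int z \<longleftrightarrow> int a - int b = 2 * z"
      by (simp only: of_int_eq_iff)
  qed
  also have "\<dots> \<longleftrightarrow> even (int a - int b)"
    by (simp add: dvd_def)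
  finally show ?thesis
    by (auto simp: to_torus_eq_iff)
qed

text \<open>Multiplying by 8 turns equality in the torus into a congruence between
  \<open>4 * a\<close> and \<open>b\<close> modulo 8.\<close>

lemma to_torus_half_eq_eighth_iff:
  "to_torus (real a / 2) = to_torus (real b / 2 ^ 3) \<longleftrightarrow> b mod 8 = 4 * (a mod 2)"
proof -
  have "real a / 2 - real b / 2 ^ 3 \<in> \<int> \<longleftrightarrow> (\<exists>z. real a / 2 - real b / 2 ^ 3 = of_int z)"
    by (auto elim: Ints_cases)
  also have "\<dots> \<longleftrightarrow> (\<exists>z. 4 * int a - int b = 8 * z)"
  proof (intro ex_cong1)
    fix z
    have "real a / 2 - real b / 2 ^ 3 = of_int z \<longleftrightarrow>
        real_of_int (4 * int a - int b) = real_of_int (8 * z)"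
      by (auto simp: field_simps)
    then show "real a / 2 - real b / 2 ^ 3 = of_int z \<longleftrightarrow> 4 * int a - int b = 8 * z"
      by (simp only: of_int_eq_iff)
  qed
  also have "\<dots> \<longleftrightarrow> int (4 * a) mod int 8 = int b mod int 8"
    by (simp add: mod_eq_dvd_iff dvd_def)
  also have "\<dots> \<longleftrightarrow> b mod 8 = 4 * (a mod 2)"
    unfolding zmod_int[symmetric] of_nat_eq_iff using mult_mod_right[of 4 a 2] by auto
  finally show ?thesis
    by (simp add: to_torus_eq_iff)
qed

section \<open>Subsets as points of the cube and as multilinear monomials\<close>

definition set_point :: "nat \<Rightarrow> nat set \<Rightarrow> nat \<Rightarrow> bit" where
  "set_point n X = (\<lambda>i\<in>{..<n}. of_bool (i \<in> X))"

lemma bij_betw_set_point: "bij_betw (set_point n) (Pow {..<n}) (F2_pow n)"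
proof (rule bij_betwI[where g = "\<lambda>x. {i. i < n \<and> x i = 1}"])
  show "set_point n \<in> Pow {..<n} \<rightarrow> F2_pow n"
    by (auto simp: set_point_def F2_pow_def)
  show "(\<lambda>x. {i. i < n \<and> x i = 1}) \<in> F2_pow n \<rightarrow> Pow {..<n}"
    by auto
  show "{i. i < n \<and> set_point n X i = 1} = X" if "X \<in> Pow {..<n}" for X
    using that by (auto simp: set_point_def)
  show "set_point n {i. i < n \<and> x i = 1} = x" if "x \<in> F2_pow n" for x
  proof
    fix i show "set_point n {i. i < n \<and> x i = 1} i = x i"
      using that by (cases "x i") (auto simp: set_point_def F2_pow_def PiE_def extensional_def)
  qed
qed

lemma agreement_eq_card:
  "agreement n F P = real (card {X \<in> Pow {..<n}. F (set_point n X) = P (set_point n X)}) / 2 ^ n"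
proof -
  have fin: "finite (F2_pow n)"
    using bij_betw_finite[OF bij_betw_set_point[of n]] by simp
  have card: "card (F2_pow n) = 2 ^ n"
    using bij_betw_same_card[OF bij_betw_set_point[of n]] by (simp add: card_Pow)
  then have "F2_pow n \<noteq> {}"
    by auto
  moreover have "card {X \<in> Pow {..<n}. F (set_point n X) = P (set_point n X)} =
      card (F2_pow n \<inter> {x. F x = P x})"
    by (rule bij_betw_same_card[of "set_point n"], rule bij_betw_subset[OF bij_betw_set_point])
      (use bij_betw_set_point[of n] in \<open>auto simp: bij_betw_def\<close>)
  ultimately show ?thesis
    unfolding agreement_def using fin card by (simp add: measure_pmf_of_set)
qed

text \<open>As with \<open>set_point\<close>, the function is restricted to \<open>{..<n}\<close>
  because the index set consists of extensional functions.\<close>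

definition set_exponent :: "nat \<Rightarrow> nat set \<Rightarrow> nat \<Rightarrow> nat" where
  "set_exponent n S = (\<lambda>i\<in>{..<n}. of_bool (i \<in> S))"

lemma bij_betw_set_exponent: "bij_betw (set_exponent n) (Pow {..<n}) ({..<n} \<rightarrow>\<^sub>E {0, 1})"
proof (rule bij_betwI[where g = "\<lambda>e. {i. i < n \<and> e i = 1}"])
  show "set_exponent n \<in> Pow {..<n} \<rightarrow> ({..<n} \<rightarrow>\<^sub>E {0, 1})"
    by (auto simp: set_exponent_def)
  show "(\<lambda>e. {i. i < n \<and> e i = 1}) \<in> ({..<n} \<rightarrow>\<^sub>E {0, 1}) \<rightarrow> Pow {..<n}"
    by auto
  show "{i. i < n \<and> set_exponent n X i = 1} = X" if "X \<in> Pow {..<n}" for X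
    using that by (auto simp: set_exponent_def)
  show "set_exponent n {i. i < n \<and> e i = 1} = e" if "e \<in> {..<n} \<rightarrow>\<^sub>E {0, 1}" for e
  proof
    fix i show "set_exponent n {i. i < n \<and> e i = 1} i = e i"
      using that by (auto simp: set_exponent_def PiE_def extensional_def)
  qed
qed

lemma sum_set_exponent:
  assumes "S \<subseteq> {..<n}"
  shows "(\<Sum>i<n. set_exponent n S i) = card S"
proof -
  have "(\<Sum>i<n. set_exponent n S i) = (\<Sum>i<n. of_bool (i \<in> S))"
    by (intro sum.cong) (auto simp: set_exponent_def)
  also have "\<dots> = card S"
    using assms by (subst sum_of_bool_eq) (auto intro!: arg_cong[of _ _ card])
  finally show ?thesis .
qed

lemma prod_set_exponent:
  assumes "S \<subseteq> {..<n}"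
  shows "(\<Prod>i<n. (of_bool (set_point n X i = 1) :: real) ^ set_exponent n S i) = of_bool (S \<subseteq> X)"
proof -
  \<comment> \<open>Coordinates outside \<open>S\<close> contribute 1, including where the point is
    0, since \<open>0 ^ 0 = 1\<close>.\<close>
  have "(\<Prod>i<n. (of_bool (set_point n X i = 1) :: real) ^ set_exponent n S i) =
      (\<Prod>i<n. of_bool (i \<in> S \<longrightarrow> i \<in> X))"
    by (intro prod.cong) (auto simp: set_exponent_def set_point_def)
  also have "\<dots> = of_bool (\<forall>i<n. i \<in> S \<longrightarrow> i \<in> X)"
    by (induction n) (auto simp: less_Suc_eq)
  also have "(\<forall>i<n. i \<in> S \<longrightarrow> i \<in> X) = (S \<subseteq> X)"
    using assms by auto
  finally show ?thesis .
qed

lemma nc_index_eq: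
  "nc_index n d = (\<lambda>(S, k). (set_exponent n S, k)) `
     {(S, k). S \<subseteq> {..<n} \<and> 1 \<le> k \<and> card S + (k - 1) \<le> d}" (is "_ = ?f ` ?A")
proof (intro set_eqI iffI)
  fix z assume z: "z \<in> nc_index n d"
  obtain e k where ek: "z = (e, k)" by force
  from z ek obtain S where S: "S \<subseteq> {..<n}" "e = set_exponent n S"
    using bij_betw_set_exponent[of n] unfolding nc_index_def bij_betw_def by blast
  with z ek have "(S, k) \<in> ?A"
    by (simp add: nc_index_def sum_set_exponent) linarith
  with ek S show "z \<in> ?f ` ?A"
    by (intro image_eqI[of _ _ "(S, k)"]) auto
next
  fix z assume "z \<in> ?f ` ?A"
  then obtain S k where "z = (set_exponent n S, k)" "S \<subseteq> {..<n}" "1 \<le> k" "card S + (k - 1) \<le> d"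
    by auto
  moreover have "set_exponent n S \<in> {..<n} \<rightarrow>\<^sub>E {0, 1}"
    by (auto simp: set_exponent_def)
  ultimately show "z \<in> nc_index n d"
    by (simp add: nc_index_def sum_set_exponent)
qed

lemma finite_nc_index: "finite (nc_index n d)"
  unfolding nc_index_eq
  by (rule finite_imageI, rule finite_subset[of _ "Pow {..<n} \<times> {..Suc d}"]) auto

text \<open>When only one denominator \<open>2 ^ q\<close> occurs, evaluation is a sum over subsets
  of the support. It serves \<open>q = 1\<close> for classical polynomials and \<open>q = 3\<close>
  for the non-classical one.\<close>

lemma nc_eval_set_point:
  assumes X: "X \<subseteq> {..<n}"
    and c: "\<And>e k. (e, k) \<in> nc_index n d \<Longrightarrow> k \<noteq> q \<Longrightarrow> c e k = 0" and q: "q \<ge> 1"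
  shows "nc_eval n d \<alpha> c (set_point n X) = \<alpha> + to_torus (real (\<Sum>S | S \<subseteq> X \<and> card S + (q - 1) \<le> d.
            c (set_exponent n S) q) / 2 ^ q)"
proof -
  let ?g = "\<lambda>(e, k). real (c e k) * (\<Prod>i<n. (of_bool (set_point n X i = 1) :: real) ^ e i) / 2 ^ k"
  let ?B = "{S. S \<subseteq> {..<n} \<and> card S + (q - 1) \<le> d}"
  have inj: "inj_on (\<lambda>S. (set_exponent n S, q)) ?B"
    using bij_betw_set_exponent[of n] by (auto simp: bij_betw_def inj_on_def)
  have "(\<Sum>z\<in>nc_index n d. ?g z) = (\<Sum>z\<in>(\<lambda>S. (set_exponent n S, q)) ` ?B. ?g z)"
  proof (rule sum.mono_neutral_right[OF finite_nc_index])
    show "(\<lambda>S. (set_exponent n S, q)) ` ?B \<subseteq> nc_index n d"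
      using q by (auto simp: nc_index_eq)
    show "\<forall>z\<in>nc_index n d - (\<lambda>S. (set_exponent n S, q)) ` ?B. ?g z = 0"
    proof
      fix z assume z: "z \<in> nc_index n d - (\<lambda>S. (set_exponent n S, q)) ` ?B"
      then obtain S k where S: "z = (set_exponent n S, k)" "S \<subseteq> {..<n}" "card S + (k - 1) \<le> d"
        by (auto simp: nc_index_eq)
      then have "k \<noteq> q" using z by auto
      then show "?g z = 0" using c[of "set_exponent n S" k] z S by simp
    qed
  qed
  also have "\<dots> = (\<Sum>S\<in>?B. real (c (set_exponent n S) q) * of_bool (S \<subseteq> X) / 2 ^ q)"
    by (subst sum.reindex[OF inj]) (auto simp: prod_set_exponent intro!: sum.cong)
  also have "\<dots> = (\<Sum>S | S \<subseteq> X \<and> card S + (q - 1) \<le> d. real (c (set_exponent n S) q) / 2 ^ q)"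
    using X by (intro sum.mono_neutral_cong_right) auto
  finally show ?thesis
    by (simp add: nc_eval_def sum_divide_distrib)
qed

lemma classical_poly_set_point:
  assumes "classical_poly n d P"
  obtains b and a :: "nat set \<Rightarrow> nat" where
    "\<And>X. X \<subseteq> {..<n} \<Longrightarrow> P (set_point n X) =
       to_torus (real (b + (\<Sum>S | S \<subseteq> X \<and> card S < Suc d. a S)) / 2)"
proof -
  from assms obtain \<alpha> c where rep: "nc_represents n d \<alpha> c P" and \<alpha>: "\<alpha> \<in> {0, to_torus (1 / 2)}"
    and depth: "nc_depth n d c = 1"
    unfolding classical_poly_def by blast
  from \<alpha> obtain b :: nat where b: "\<alpha> = to_torus (real b / 2)"
  proof
    assume "\<alpha> = 0" then show ?thesis by (intro that[of 0]) (simp add: to_torus_0)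
  next
    assume "\<alpha> \<in> {to_torus (1 / 2)}" then show ?thesis by (intro that[of 1]) simp
  qed
  have c: "c e k = 0" if "(e, k) \<in> nc_index n d" "k \<noteq> 1" for e k
  proof (rule ccontr)
    assume ne: "c e k \<noteq> 0"
    let ?K = "{k. \<exists>e. (e, k) \<in> nc_index n d \<and> c e k \<noteq> 0}"
    have "?K \<subseteq> snd ` nc_index n d" by force
    then have "finite ?K" using finite_nc_index finite_surj by blast
    then have "k \<le> nc_depth n d c"
      unfolding nc_depth_def using ne that(1) by (intro Max_ge) auto
    \<comment> \<open>Indices start at 1, so \<open>k \<noteq> 1\<close> would exceed the depth
      1.\<close>
    with depth that show False by (auto simp: nc_index_def)
  qed
  show ?thesis
  proof (rule that[of b "\<lambda>S. c (set_exponent n S) 1"])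
    fix X assume X: "X \<subseteq> {..<n}"
    have "set_point n X \<in> F2_pow n"
      using bij_betw_set_point[of n] X by (auto dest: bij_betwE)
    then have "P (set_point n X) = nc_eval n d \<alpha> c (set_point n X)"
      using rep by (auto simp: nc_represents_def)
    also have "\<dots> = \<alpha> + to_torus (real (\<Sum>S | S \<subseteq> X \<and> card S + (1 - 1) \<le> d.
            c (set_exponent n S) 1) / 2 ^ 1)"
      by (rule nc_eval_set_point) (use X c in auto)
    also have "\<dots> = to_torus (real (b + (\<Sum>S | S \<subseteq> X \<and> card S < Suc d. c (set_exponent n S) 1)) / 2)"
      by (simp add: b to_torus_add less_Suc_eq_le add_divide_distrib)
    finally show "P (set_point n X) =
        to_torus (real (b + (\<Sum>S | S \<subseteq> X \<and> card S < Suc d. c (set_exponent n S) 1)) / 2)" .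
  qed
qed

text \<open>The elementary symmetric polynomial of degree \<open>s\<close> counts the
  \<open>s\<close>-subsets of the support; the denominator \<open>2 ^ q\<close> costs
  \<open>q - 1\<close> further degrees.\<close>

lemma nonclassical_poly_symmetric:
  assumes "q \<ge> 1"
  obtains P where "nonclassical_poly n (s + (q - 1)) P"
    "\<And>X. X \<subseteq> {..<n} \<Longrightarrow> P (set_point n X) = to_torus (real (card X choose s) / 2 ^ q)"
proof -
  define c :: "(nat \<Rightarrow> nat) \<Rightarrow> nat \<Rightarrow> nat" where "c e k = of_bool (k = q \<and> (\<Sum>i<n. e i) = s)" for e k
  let ?d = "s + (q - 1)"
  define P where "P = nc_eval n ?d 0 c"
  have "nc_represents n ?d 0 c P"
    by (auto simp: nc_represents_def P_def c_def)
  then have "nonclassical_poly n ?d P"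
    \<comment> \<open>The shift 0 is admissible for every depth, with \<open>A = 0\<close>.\<close>
    unfolding nonclassical_poly_def
    by (intro exI[of _ 0] exI[of _ c] conjI bexI[of _ 0]) (auto simp: to_torus_0)
  moreover have "P (set_point n X) = to_torus (real (card X choose s) / 2 ^ q)" if X: "X \<subseteq> {..<n}" for X
  proof -
    have fin: "finite X" using X finite_subset by blast
    have "P (set_point n X) = 0 + to_torus (real (\<Sum>S | S \<subseteq> X \<and> card S + (q - 1) \<le> ?d.
            c (set_exponent n S) q) / 2 ^ q)"
      unfolding P_def by (rule nc_eval_set_point) (use X assms in \<open>auto simp: c_def\<close>)
    also have "(\<Sum>S | S \<subseteq> X \<and> card S + (q - 1) \<le> ?d. c (set_exponent n S) q) =
        (\<Sum>S | S \<subseteq> X \<and> card S = s. 1)"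
      using fin X by (intro sum.mono_neutral_cong_right) (auto simp: c_def sum_set_exponent)
    also have "\<dots> = card X choose s"
      using n_subsets[OF fin] by simp
    finally show ?thesis by simp
  qed
  ultimately show ?thesis by (rule that)
qed

section \<open>A binary digit of the weight\<close>

text \<open>Halving in the torus retains only the parity of the quotient by 16.\<close>

definition weight_bit :: "nat \<Rightarrow> (nat \<Rightarrow> bit) \<Rightarrow> torus" where
  "weight_bit n x = to_torus (real (card {i. i < n \<and> x i = 1} div 16) / 2)"

lemma weight_bit_set_point:
  assumes "X \<subseteq> {..<n}"
  shows "weight_bit n (set_point n X) = to_torus (real (card X div 16) / 2)"
proof -
  have "{i. i < n \<and> set_point n X i = 1} = X"
    using assms by (auto simp: set_point_def)
  then show ?thesis by (simp add: weight_bit_def)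
qed

lemma boolean_fun_weight_bit: "boolean_fun n (weight_bit n)"
proof -
  have "to_torus (real m / 2) \<in> {0, to_torus (1 / 2)}" for m
    using to_torus_half_eq_iff[of m 0] to_torus_half_eq_iff[of m 1] by (auto simp: to_torus_0)
  then show ?thesis
    unfolding boolean_fun_def weight_bit_def by blast
qed

lemma weight_bit_classical_agreement:
  assumes "d < 16" "\<epsilon> > 0"
  shows "\<exists>N. \<forall>n\<ge>N. \<forall>P. classical_poly n d P \<longrightarrow> agreement n (weight_bit n) P \<le> 1 / 2 + \<epsilon>"
proof -
  have "Suc d \<le> 16" using assms(1) by simp
  from polynomial_agreement_le[OF this assms(2), where 'a = nat] obtain N where
    N: "\<forall>V h c a. finite V \<longrightarrow> N \<le> card V \<longrightarrow> (\<forall>k. even (h (k + 16)) = even (h k :: nat)) \<longrightarrow>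
     real (card {X \<in> Pow V. odd ((card X + c) div 16) =
       odd (h (card X) + (\<Sum>S | S \<subseteq> X \<and> card S < Suc d. a (S :: nat set) :: nat))})
     \<le> (1 / 2 + \<epsilon>) * 2 ^ card V" ..
  show ?thesis
  proof (intro exI[of _ N] allI impI)
    fix n P assume n: "N \<le> n" and P: "classical_poly n d P"
    obtain b and a :: "nat set \<Rightarrow> nat" where ab: "\<And>X. X \<subseteq> {..<n} \<Longrightarrow>
        P (set_point n X) = to_torus (real (b + (\<Sum>S | S \<subseteq> X \<and> card S < Suc d. a S)) / 2)"
      by (rule classical_poly_set_point[OF P]) blast
    have "{X \<in> Pow {..<n}. weight_bit n (set_point n X) = P (set_point n X)} =
        {X \<in> Pow {..<n}. odd ((card X + 0) div 16) = odd (b + (\<Sum>S | S \<subseteq> X \<and> card S < Suc d. a S))}"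
      by (intro Collect_cong conj_cong refl)
        (simp only: Pow_iff weight_bit_set_point ab to_torus_half_eq_iff add_0_right)
    \<comment> \<open>The shift of the classical polynomial enters as a constant symmetric
      part.\<close>
    then show "agreement n (weight_bit n) P \<le> 1 / 2 + \<epsilon>"
      using N[rule_format, of "{..<n}" "\<lambda>_. b" 0 a] n
      by (simp add: agreement_eq_card divide_le_eq)
  qed
qed

section \<open>Counting agreements over the residues modulo 64\<close>

lemma fact_mult_choose: "fact k * (n choose k) = (\<Prod>i<k. n - i)"
proof (induction k arbitrary: n)
  case (Suc k)
  have "fact (Suc k) * (n choose Suc k) = n * (fact k * ((n - 1) choose k))"
    by (simp only: fact_Suc of_nat_id mult.commute[of "Suc k"] mult.assoc binomial_absorption
        mult.left_commute[of n])
  also have "\<dots> = (\<Prod>i<Suc k. n - i)"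
    by (subst prod.lessThan_Suc_shift) (simp add: Suc)
  finally show ?case .
qed simp

lemma count_choose_12:
  "length (filter (\<lambda>j. (j choose 12) mod 8 = 4 * ((j div 16) mod 2)) [0..<64]) = (36::nat)"
proof -
  \<comment> \<open>Falling factorials over \<open>fact 12 = 479001600\<close> make the 64 cases
    evaluable by arithmetic; truncated subtraction gives the value 0 for
    \<open>j < 12\<close>.\<close>
  have "j choose 12 = (\<Prod>i<12. j - i) div fact 12" for j :: nat
    by (simp flip: fact_mult_choose)
  then have *: "j choose 12 = j * (j - 1) * (j - 2) * (j - 3) * (j - 4) * (j - 5) * (j - 6) *
      (j - 7) * (j - 8) * (j - 9) * (j - 10) * (j - 11) div 479001600" for j :: nat
    by (simp add: lessThan_nat_numeral fact_numeral ac_simps)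
  have upt: "[0..<64] = 0 # 1 # [2..<64]"
    using upt_conv_Cons[of 0 64] upt_conv_Cons[of 1 64] by (simp add: numeral_2_eq_2[symmetric])
  show ?thesis
    unfolding * upt by simp
qed

text \<open>Agreement depends only on the weight modulo 64, and \<open>36 / 64 = 9 / 16\<close> of
  the residues agree.\<close>

lemma weight_bit_symmetric_agreement:
  assumes "\<And>X. X \<subseteq> {..<n} \<Longrightarrow> P (set_point n X) = to_torus (real (card X choose 12) / 2 ^ 3)"
  shows "agreement n (weight_bit n) P \<ge> 9 / 16 - osc 64 n"
proof -
  define Q where "Q k \<longleftrightarrow> (k choose 12) mod 8 = 4 * ((k div 16) mod 2)" for k :: nat
  let ?g = "\<lambda>k. of_bool (Q k) :: real"
  have "(k + 64) div 16 mod 2 = k div 16 mod 2" for k :: nat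
    using div_mult_self1[of 16 k 4] by (simp add: mod_add_eq[symmetric])
  \<comment> \<open>With \<open>a = 4\<close> and \<open>b = 2\<close>, \<open>choose 12\<close>
    modulo 8 has period \<open>2 ^ 6\<close>.\<close>
  then have per: "?g (k + 64) = ?g k" for k
    using choose_add_power_2_mod[of 12 4 k 2] by (simp add: Q_def)
  have "{X \<in> Pow {..<n}. weight_bit n (set_point n X) = P (set_point n X)} =
      {X \<in> Pow {..<n}. Q (card X)}"
    by (intro Collect_cong conj_cong refl)
      (simp only: Pow_iff weight_bit_set_point assms to_torus_half_eq_eighth_iff Q_def)
  then have "agreement n (weight_bit n) P = weight_mean ?g n 0"
    by (simp only: agreement_eq_card card_Pow_weight finite_lessThan) simp
  moreover have "(\<Sum>j<64. ?g j) = 36"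
  proof -
    have "(\<Sum>j<64. ?g j) = real (card {j \<in> {..<64}. Q j})"
      by (subst sum_of_bool_eq) (auto intro!: arg_cong[of _ _ card])
    also have "{j \<in> {..<64}. Q j} = set (filter Q [0..<64])"
      by auto
    also have "card \<dots> = 36"
      using count_choose_12 by (subst distinct_card) (simp_all add: Q_def[abs_def])
    finally show ?thesis by simp
  qed
  ultimately show ?thesis
    using weight_mean_period_mean[of ?g 64 n, OF per] by simp
qed

theorem theorem5p7:
  shows "\<exists>d\<ge>1. \<exists>(F :: nat \<Rightarrow> (nat \<Rightarrow> bit) \<Rightarrow> torus) (\<epsilon> :: nat \<Rightarrow> real) (c :: real).
    \<epsilon> \<longlonglongrightarrow> 0 \<and> c > 0 \<and>
    (\<forall>n. boolean_fun n (F n) \<and>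
       (\<forall>P. classical_poly n d P \<longrightarrow> agreement n (F n) P \<le> 1/2 + \<epsilon> n) \<and>
       (\<exists>d'\<le>d. \<exists>P'. nonclassical_poly n d' P' \<and> agreement n (F n) P' \<ge> 1/2 + c))"
proof -
  have "\<forall>\<^sub>F n in sequentially. osc 64 n < 1 / 32"
    using osc_tendsto_0[of 64] by (intro order_tendstoD(2)[where y = 0]) auto
  \<comment> \<open>The limiting surplus is 1/16; an error below 1/32 leaves the constant
    1/32.\<close>
  then obtain n0 where n0: "\<And>n. n \<ge> n0 \<Longrightarrow> osc 64 n < 1 / 32"
    by (auto simp: eventually_sequentially)
  \<comment> \<open>For small \<open>n\<close> the zero function is used: the zero polynomial agrees
    with it everywhere, and the limit is unaffected.\<close>
  define F where "F n = (if n \<ge> n0 then weight_bit n else (\<lambda>_. 0))" for n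
  \<comment> \<open>Taking the positive part, and 0 for non-classical \<open>P\<close>, gives a
    bounded non-negative family over all \<open>P\<close>. Its supremum satisfies the upper bound by
    construction, leaving only convergence to be shown.\<close>
  define \<delta> where "\<delta> n P = (if classical_poly n 14 P then max 0 (agreement n (F n) P - 1 / 2) else 0)"
    for n P
  define \<epsilon> where "\<epsilon> n = (SUP P. \<delta> n P)" for n
  have bdd: "bdd_above (range (\<delta> n))" for n
  proof (rule bdd_aboveI[of _ 1])
    fix y assume "y \<in> range (\<delta> n)"
    then obtain P where "y = \<delta> n P" by blast
    moreover have "agreement n (F n) P \<le> 1"
      unfolding agreement_def by (rule measure_pmf.prob_le_1)
    ultimately show "y \<le> 1" by (simp add: \<delta>_def)
  qed
  have \<delta>_le: "\<delta> n P \<le> \<epsilon> n" for n P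
    unfolding \<epsilon>_def by (rule cSUP_upper[OF UNIV_I bdd])
  have "\<epsilon> \<longlonglongrightarrow> 0"
  proof (rule LIMSEQ_I)
    fix r :: real assume "r > 0"
    \<comment> \<open>The supremum inherits only a weak bound \<open>s\<close>, hence the room
      between \<open>s\<close> and \<open>r\<close>.\<close>
    then obtain s where s: "0 < s" "s < r"
      using dense by blast
    obtain N where N: "\<And>n P. n \<ge> N \<Longrightarrow> classical_poly n 14 P \<Longrightarrow>
        agreement n (weight_bit n) P \<le> 1 / 2 + s"
      using weight_bit_classical_agreement[of 14 s] s(1) by auto
    show "\<exists>N. \<forall>n\<ge>N. norm (\<epsilon> n - 0) < r"
    proof (intro exI[of _ "max N n0"] allI impI)
      fix n assume n: "max N n0 \<le> n"
      have "\<epsilon> n \<le> s"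
        unfolding \<epsilon>_def
      proof (rule cSUP_least)
        fix P
        show "\<delta> n P \<le> s"
          using N[of n P] n s(1) by (auto simp: \<delta>_def F_def algebra_simps)
      qed simp
      moreover have "\<epsilon> n \<ge> 0"
        using \<delta>_le[of n undefined] by (rule order_trans[rotated]) (simp add: \<delta>_def)
      ultimately show "norm (\<epsilon> n - 0) < r"
        using s by simp
    qed
  qed
  moreover have "boolean_fun n (F n)" for n
    using boolean_fun_weight_bit by (auto simp: F_def boolean_fun_def)
  moreover have "agreement n (F n) P \<le> 1 / 2 + \<epsilon> n" if "classical_poly n 14 P" for n P
    using \<delta>_le[of n P] that by (simp add: \<delta>_def)
  moreover have "\<exists>d'\<le>14. \<exists>P'. nonclassical_poly n d' P' \<and> agreement n (F n) P' \<ge> 1 / 2 + 1 / 32" for n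
  proof (cases "n \<ge> n0")
    case True
    obtain P where P: "nonclassical_poly n (12 + (3 - 1)) P"
      "\<And>X. X \<subseteq> {..<n} \<Longrightarrow> P (set_point n X) = to_torus (real (card X choose 12) / 2 ^ 3)"
      using nonclassical_poly_symmetric[of 3 n 12] by auto
    have "agreement n (F n) P \<ge> 1 / 2 + 1 / 32"
      using weight_bit_symmetric_agreement[of n P, OF P(2)] n0[OF True] True by (simp add: F_def)
    with P(1) show ?thesis by (intro exI[of _ 14]) auto
  next
    case False
    \<comment> \<open>With all coefficients zero the depth is 0, so \<open>A = 0\<close> is the only
      choice.\<close>
    have "nonclassical_poly n 14 (\<lambda>_. 0)"
      unfolding nonclassical_poly_def
      by (intro exI[of _ 0] exI[of _ "\<lambda>_ _. 0"] conjI bexI[of _ 0])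
        (auto simp: nc_represents_def nc_eval_def to_torus_0 case_prod_beta)
    moreover have "agreement n (F n) (\<lambda>_. 0) = 1"
      using False by (simp add: F_def agreement_def)
    ultimately show ?thesis by (intro exI[of _ 14] conjI exI[of _ "\<lambda>_. 0"]) auto
  qed
  ultimately show ?thesis
    by (intro exI[of _ 14] conjI exI[of _ F] exI[of _ \<epsilon>] exI[of _ "1 / 32"]) auto
qed

end
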